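(* Let $d$ be a positive integer and let $\mathcal{C}_1,\dots,\mathcal{C}_{d(d+3)/2}$ be finite families of convex bodies in $\mathbb{R}^d$. Assume that for any colorful selection $C_1\in\mathcal{C}_1,\dots,C_{d(d+3)/2}\in\mathcal{C}_{d(d+3)/2}$, the intersection $\bigcap_{i=1}^{d(d+3)/2} C_i$ contains an ellipsoid of volume $1$. Then for some $j\in\{1,\dots,d(d+3)/2\}$, the intersection $\bigcap_{C\in\mathcal{C}_j} C$ contains an ellipsoid of volume $1$.
   Context: A convex body in $\mathbb{R}^d$ is a compact convex set with non-empty interior. An ellipsoid in $\mathbb{R}^d$ is an image of the closed Euclidean unit ball under a non-singular affine map. Volume is $d$-dimensional Lebesgue measure. *)

theory Defs
  imports "HOL-Analysis.Analysis"
begin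

definition convex_body :: "(real ^ 'n) set \<Rightarrow> bool" where
  "convex_body K \<longleftrightarrow> compact K \<and> convex K \<and> interior K \<noteq> {}"

definition ellipsoid :: "(real ^ 'n) set \<Rightarrow> bool" where
  "ellipsoid E \<longleftrightarrow>
     (\<exists>(A :: real ^ 'n ^ 'n) b. invertible A \<and> E = (\<lambda>x. A *v x + b) ` cball 0 1)"

definition contains_ellipsoid_of_volume_1 :: "(real ^ 'n) set \<Rightarrow> bool" where
  "contains_ellipsoid_of_volume_1 S \<longleftrightarrow>
     (\<exists>E. ellipsoid E \<and> measure lebesgue E = 1 \<and> E \<subseteq> S)"

end

theory Submission
  imports Defs
begin

text \<open>
  Every ellipsoid in dimension \<open>d\<close> can be written as \<open>L B + b\<close>, where \<open>B\<close> is the unit ball and \<open>L\<close>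
  is lower triangular with positive diagonal: a matrix \<open>A\<close> and \<open>A Q\<close> with \<open>Q\<close> orthogonal map \<open>B\<close> to
  the same set, and a Gram-Schmidt process makes \<open>A Q\<close> triangular. The pairs \<open>(L, b)\<close> form a space
  \<open>S\<close> of dimension \<open>N = d (d + 3) / 2\<close>, which is the number of colours. For a closed convex body \<open>C\<close>,
  the set \<open>K C\<close> of pairs with \<open>L B + b \<subseteq> C\<close> is closed and convex. So is the set \<open>D\<close> of pairs of
  volume at least one, because the volume is a multiple of the product of the diagonal entries and
  the weighted inequality between arithmetic and geometric means applies. Shrinking an ellipsoid
  about its centre brings its volume down to exactly one, hence \<open>C\<close> contains an ellipsoid of volume
  one iff \<open>D\<close> meets \<open>K C\<close> (\<open>contains_ellipsoid_iff_params\<close>).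

  The remaining argument is that of Lovasz, with the Euclidean norm on the parameters as the
  function to be minimised (\<open>colourful_Helly_min_norm\<close>). Among all selections of bodies from all
  colours but one, pick one for which the point \<open>x\<close> of least norm in \<open>D \<inter> \<Inter>K\<close> has the largest norm.
  Adding any body \<open>C\<close> of the missing colour gives a point \<open>y\<close> of least norm for the full selection.
  The open ball of radius \<open>norm y\<close>, the set \<open>D\<close> and the \<open>N\<close> sets \<open>K\<close> have no common point in \<open>S\<close>,
  so by Helly's theorem \<open>N + 1\<close> of these \<open>N + 2\<close> sets have none. The omitted set is not the ball,
  as \<open>y\<close> lies in all the others; it is not \<open>D\<close>, as replacing \<open>L\<close> by \<open>L / 2\<close> keeps the ellipsoid
  inside the bodies and lowers the norm. Thus it is one of the sets \<open>K\<close>, and by the choice of \<open>x\<close> the norm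
  of \<open>y\<close> is at most that of \<open>x\<close>. But \<open>y\<close> also satisfies the constraints under which \<open>x\<close> has least
  norm, and points of least norm in closed convex sets are unique, therefore \<open>y = x\<close>.
  Hence \<open>x\<close> lies in \<open>K C\<close> for all \<open>C\<close> of the missing colour, and shrinking its ellipsoid proves the
  theorem.
\<close>

section \<open>Helly's theorem in a subspace\<close>

text \<open>
  One step of Helly's theorem, for sets with indices, since different indices may carry the same
  set. Take for each \<open>j\<close> a point of \<open>S\<close> in all sets but the one at \<open>j\<close>. If two of these points
  coincide, they lie in every set. Otherwise they are affinely dependent, being more than
  \<open>dim S + 1\<close> points of \<open>S\<close>, and the two hulls of a Radon partition meet in a common point.
\<close>

lemma Helly_subspace:
  fixes X :: "'i \<Rightarrow> 'a::euclidean_space set"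
  assumes "finite J" and card: "dim S + 2 \<le> card J"
    and "\<And>j. j \<in> J \<Longrightarrow> convex (X j)"
    and omit: "\<And>j. j \<in> J \<Longrightarrow> S \<inter> (\<Inter>i\<in>J - {j}. X i) \<noteq> {}"
  shows "(\<Inter>j\<in>J. X j) \<noteq> {}"
proof -
  have "\<forall>j\<in>J. \<exists>x. x \<in> S \<inter> (\<Inter>i\<in>J - {j}. X i)"
    using omit by blast
  then obtain p where p: "\<forall>j\<in>J. p j \<in> S \<inter> (\<Inter>i\<in>J - {j}. X i)"
    by (rule bchoice[THEN exE])
  then have pS: "p j \<in> S" if "j \<in> J" for j
    using that by blast
  have pX: "p j \<in> X i" if "j \<in> J" "i \<in> J" "i \<noteq> j" for i j
    using p that by blast
  show ?thesis
  proof (cases "inj_on p J")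
    case False
    then obtain i j where ij: "i \<in> J" "j \<in> J" "i \<noteq> j" "p i = p j"
      by (auto simp: inj_on_def)
    have "p i \<in> X k" if "k \<in> J" for k
      using pX[of i k] pX[of j k] ij that by (cases "k = i") auto
    then show ?thesis by blast
  next
    case True
    have "dim (p ` J) \<le> dim S"
      using pS by (intro dim_subset) blast
    then have "affine_dependent (p ` J)"
      using card card_image[OF True] \<open>finite J\<close>
      by (intro affine_dependent_biggerset_general) auto
    then obtain M P where MP: "M \<inter> P = {}" "M \<union> P = p ` J"
      and "convex hull M \<inter> convex hull P \<noteq> {}"
      using Radon_partition[of "p ` J"] \<open>finite J\<close> by blast
    then obtain z where z: "z \<in> convex hull M" "z \<in> convex hull P" by blast
    have "z \<in> X k" if k: "k \<in> J" for k
    proof -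
      have *: "z \<in> X k" if "z \<in> convex hull Q" "Q \<subseteq> p ` J" "p k \<notin> Q" for Q
      proof -
        have "Q \<subseteq> X k"
          using that pX[OF _ k] by blast
        then show ?thesis
          using hull_minimal[of Q "X k" convex] \<open>z \<in> convex hull Q\<close> assms(3)[OF k] by blast
      qed
      have "M \<subseteq> p ` J" "P \<subseteq> p ` J" "p k \<notin> M \<or> p k \<notin> P"
        using MP by blast+
      then show ?thesis
        using * [of M] * [of P] z by metis
    qed
    then show ?thesis by blast
  qed
qed

section \<open>An optimisation form of the colourful Helly theorem\<close>

text \<open>
  The colourful Helly theorem in a space of dimension \<open>n\<close> needs \<open>n + 1\<close> colours. Here \<open>n\<close> colours
  suffice because of the last hypothesis: without the constraint \<open>D\<close> the norm can be decreased at
  every point of \<open>D\<close>. Let \<open>r\<close> be the least norm in \<open>D\<close> and the sets of a full selection. Then \<open>n + 1\<close>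
  sets without a common point, among these sets and the open ball of radius \<open>r\<close>, include both the ball
  and \<open>D\<close>, which leaves room for only \<open>n - 1\<close> of the sets \<open>K c\<close>.
\<close>

lemma colourful_Helly_min_norm:
  fixes K :: "'c \<Rightarrow> 'a::euclidean_space set" and \<C> :: "'i \<Rightarrow> 'c set"
  assumes "finite I" "I \<noteq> {}" and dim: "dim S \<le> card I"
    and D: "closed D" "convex D" "D \<noteq> {}" "D \<subseteq> S"
    and fin: "\<And>i. i \<in> I \<Longrightarrow> finite (\<C> i)"
    and K: "\<And>i c. i \<in> I \<Longrightarrow> c \<in> \<C> i \<Longrightarrow> closed (K c) \<and> convex (K c)"
    and sel: "\<And>s. (\<And>i. i \<in> I \<Longrightarrow> s i \<in> \<C> i) \<Longrightarrow> D \<inter> (\<Inter>i\<in>I. K (s i)) \<noteq> {}"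
    and descent: "\<And>x. x \<in> D \<Longrightarrow>
      \<exists>y\<in>S. norm y < norm x \<and> (\<forall>i\<in>I. \<forall>c\<in>\<C> i. x \<in> K c \<longrightarrow> y \<in> K c)"
  shows "\<exists>j\<in>I. D \<inter> (\<Inter>c\<in>\<C> j. K c) \<noteq> {}"
proof (cases "\<exists>j\<in>I. \<C> j = {}")
  case True
  then obtain j where "j \<in> I" "\<C> j = {}" by blast
  then have "D \<inter> (\<Inter>c\<in>\<C> j. K c) \<noteq> {}" using D by simp
  then show ?thesis using \<open>j \<in> I\<close> by blast
next
  case nonempty: False
  \<comment> \<open>\<open>F j s\<close> is determined by the values of \<open>s\<close> off \<open>j\<close>, so a full selection together with \<open>j\<close> encodes
    a selection from all colours but \<open>j\<close>.\<close>
  define F where "F j s = D \<inter> (\<Inter>i\<in>I - {j}. K (s i))" for j and s :: "'i \<Rightarrow> 'c"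
  define x where "x j s = closest_point (F j s) 0" for j s
  define T where "T = I \<times> PiE I \<C>"
  have F: "closed (F j s)" "convex (F j s)" "F j s \<noteq> {}" if "s \<in> PiE I \<C>" for j s
  proof -
    have s: "\<And>i. i \<in> I \<Longrightarrow> s i \<in> \<C> i" using that by blast
    show "closed (F j s)" unfolding F_def using D K s by (intro closed_Int closed_INT) auto
    show "convex (F j s)" unfolding F_def using D K s by (intro convex_Int convex_INT) auto
    show "F j s \<noteq> {}" unfolding F_def using sel[of s] s by blast
  qed
  have T: "finite T" "T \<noteq> {}"
    unfolding T_def using \<open>finite I\<close> \<open>I \<noteq> {}\<close> fin nonempty
    by (auto intro!: finite_PiE simp: PiE_eq_empty_iff)
  define m where "m = Max ((\<lambda>(j, s). norm (x j s)) ` T)"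
  have "m \<in> (\<lambda>(j, s). norm (x j s)) ` T"
    unfolding m_def using T by (intro Max_in) auto
  then obtain j s where j: "j \<in> I" and s: "s \<in> PiE I \<C>" and m: "m = norm (x j s)"
    by (auto simp: T_def)
  have max: "norm (x k t) \<le> norm (x j s)" if "k \<in> I" "t \<in> PiE I \<C>" for k t
    unfolding m[symmetric] m_def using T that by (intro Max_ge) (auto simp: T_def)
  have xF: "x j s \<in> F j s"
    unfolding x_def using F[OF s] by (intro closest_point_in_set)
  have "x j s \<in> K c" if c: "c \<in> \<C> j" for c
  proof -
    define t where "t = s(j := c)"
    have t: "t \<in> PiE I \<C>"
      unfolding t_def using s c j by (auto simp: PiE_iff extensional_def)
    then have tC: "\<And>i. i \<in> I \<Longrightarrow> t i \<in> \<C> i" by blast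
    have Ft: "F j t = F j s"
      unfolding F_def t_def by simp
    define G where "G = D \<inter> (\<Inter>i\<in>I. K (t i))"
    have G: "closed G" "convex G" "G \<noteq> {}"
      unfolding G_def using D K sel tC by (auto intro!: closed_Int closed_INT convex_Int convex_INT)
    define y where "y = closest_point G 0"
    have yG: "y \<in> G"
      unfolding y_def using G by (intro closest_point_in_set)
    have ymin: "norm y \<le> norm z" if "z \<in> G" for z
      using closest_point_le[OF G(1) that, of 0] by (simp add: y_def)
    \<comment> \<open>Dropping a suitable colour \<open>k\<close> does not lower the minimal norm; \<open>k\<close> need not be \<open>j\<close>.\<close>
    have "\<exists>k\<in>I. F k t \<inter> ball 0 (norm y) = {}"
    proof (rule ccontr)
      assume neg: "\<not> ?thesis"
      define X where "X = case_sum (\<lambda>i. K (t i)) (\<lambda>b. if b then ball 0 (norm y) else D)"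
      have XR: "X (Inl i) = K (t i)" "X (Inr True) = ball 0 (norm y)" "X (Inr False) = D" for i
        by (auto simp: X_def)
      define J where "J = (I <+> (UNIV :: bool set))"
      have "(\<Inter>j\<in>J. X j) \<noteq> {}"
      proof (rule Helly_subspace[where S = S])
        show "finite J" unfolding J_def using \<open>finite I\<close> by simp
        show "dim S + 2 \<le> card J"
          unfolding J_def using dim \<open>finite I\<close> by (simp add: card_Plus)
        show "convex (X j)" if "j \<in> J" for j
          using that D K tC by (auto simp: J_def XR UNIV_bool)
        show "S \<inter> (\<Inter>i\<in>J - {k}. X i) \<noteq> {}" if k: "k \<in> J" for k
        proof -
          consider (colour) i where "i \<in> I" "k = Inl i" | (ball) "k = Inr True" | (D) "k = Inr False"
            using k by (auto simp: J_def)
          then show ?thesis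
          proof cases
            case colour
            then obtain z where "z \<in> F i t" "z \<in> ball 0 (norm y)"
              using neg by blast
            then have "z \<in> S \<inter> (\<Inter>i\<in>J - {k}. X i)"
              using \<open>D \<subseteq> S\<close> colour by (auto simp: J_def XR F_def UNIV_bool)
            then show ?thesis by blast
          next
            case ball
            have "y \<in> S \<inter> (\<Inter>i\<in>J - {k}. X i)"
              using \<open>D \<subseteq> S\<close> yG ball by (auto simp: J_def XR G_def UNIV_bool)
            then show ?thesis by blast
          next
            case D
            obtain z where "z \<in> S" "norm z < norm y" "\<forall>i\<in>I. \<forall>c\<in>\<C> i. y \<in> K c \<longrightarrow> z \<in> K c"
              using descent[of y] yG by (auto simp: G_def)
            then have "z \<in> S \<inter> (\<Inter>i\<in>J - {k}. X i)"
              using yG D tC by (auto simp: J_def XR G_def UNIV_bool)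
            then show ?thesis by blast
          qed
        qed
      qed
      then obtain z where "z \<in> (\<Inter>j\<in>J. X j)" by blast
      then have "z \<in> X (Inr True)" "z \<in> X (Inr False)" "\<And>i. i \<in> I \<Longrightarrow> z \<in> X (Inl i)"
        by (auto simp: J_def)
      then have "z \<in> G" "norm z < norm y"
        by (auto simp: G_def XR)
      then show False using ymin by fastforce
    qed
    then obtain k where k: "k \<in> I" "F k t \<inter> ball 0 (norm y) = {}" by blast
    have "x k t \<in> F k t"
      unfolding x_def using F[OF t] by (intro closest_point_in_set)
    then have "norm y \<le> norm (x k t)"
      using k by fastforce
    also have "\<dots> \<le> norm (x j s)" using max k t by blast
    finally have le: "norm y \<le> norm (x j s)" .
    have "y \<in> F j s"
      using yG unfolding Ft[symmetric] by (auto simp: F_def G_def)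
    moreover have "\<forall>z\<in>F j s. dist 0 y \<le> dist 0 z"
      using le closest_point_le[OF F(1)[OF s], of _ j 0] by (fastforce simp: x_def)
    ultimately have "y = x j s"
      unfolding x_def using F[OF s] by (intro closest_point_unique)
    then show ?thesis
      using yG j by (auto simp: G_def t_def)
  qed
  then show ?thesis using j xF by (auto simp: F_def)
qed

section \<open>Triangular factors of a matrix\<close>

text \<open>Triangularity needs a linear order on the index type; an enumeration of it provides one.\<close>

definition position :: "'n::finite \<Rightarrow> nat" where
  "position = to_nat_on UNIV"

lemma bij_betw_position: "bij_betw position (UNIV :: 'n::finite set) {..<CARD('n)}"
  unfolding position_def by (rule to_nat_on_finite) simp

lemma position_eq_iff [simp]: "position i = position j \<longleftrightarrow> i = j"
  using bij_betw_position by (metis UNIV_I bij_betw_imp_inj_on inj_onD)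

lemma position_less: "position (i :: 'n::finite) < CARD('n)"
  using bij_betw_position[where 'n='n] by (auto simp: bij_betw_def)

definition lower_triangular :: "real ^ 'n ^ 'n \<Rightarrow> bool" where
  "lower_triangular L \<longleftrightarrow> (\<forall>i j. position i < position j \<longrightarrow> L $ i $ j = 0)"

text \<open>
  The vectors \<open>q j\<close> are chosen from the last one downwards: \<open>q k\<close> has to be orthogonal to the \<open>k\<close>
  vectors \<open>a i\<close> with \<open>i < k\<close> and to the later \<open>q j\<close>. These are fewer vectors than the dimension,
  so a choice exists even if the \<open>a i\<close> are linearly dependent.
\<close>

lemma triangularising_orthonormal_system:
  fixes a :: "nat \<Rightarrow> 'a::euclidean_space"
  shows "\<exists>q. (\<forall>i<DIM('a). \<forall>j<DIM('a). q i \<bullet> q j = (if i = j then 1 else 0)) \<and>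
    (\<forall>j<DIM('a). 0 \<le> a j \<bullet> q j \<and> (\<forall>i<j. a i \<bullet> q j = 0))"
proof -
  let ?n = "DIM('a)"
  let ?P = "\<lambda>k q. (\<forall>i\<in>{k..<?n}. \<forall>j\<in>{k..<?n}. q i \<bullet> q j = (if i = j then 1 else 0)) \<and>
    (\<forall>j\<in>{k..<?n}. 0 \<le> a j \<bullet> q j \<and> (\<forall>i<j. a i \<bullet> q j = 0))"
  have "\<exists>q. ?P k q" if "k \<le> ?n" for k
    using that
  proof (induction k rule: inc_induct)
    case base
    show ?case by simp
  next
    case (step k)
    then obtain q where q: "?P (Suc k) q" by blast
    let ?V = "a ` {..<k} \<union> q ` {Suc k..<?n}"
    have "dim ?V \<le> card ?V" by (rule dim_le_card') simp
    also have "\<dots> \<le> card (a ` {..<k}) + card (q ` {Suc k..<?n})" by (rule card_Un_le)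
    also have "\<dots> \<le> k + (?n - Suc k)"
      using card_image_le[of "{..<k}" a] card_image_le[of "{Suc k..<?n}" q] by simp
    also have "\<dots> < ?n" using step.hyps by simp
    finally obtain u where u: "u \<noteq> 0" "\<And>y. y \<in> span ?V \<Longrightarrow> orthogonal u y"
      using orthogonal_to_subspace_exists by metis
    \<comment> \<open>Normalised, with the sign that makes the diagonal entry nonnegative.\<close>
    define w where "w = (if 0 \<le> a k \<bullet> u then 1 else - 1) *\<^sub>R (u /\<^sub>R norm u)"
    have w1: "w \<bullet> w = 1"
      using u(1) by (auto simp: w_def dot_square_norm power2_eq_square field_simps)
    have wk: "0 \<le> a k \<bullet> w"
      by (auto simp: w_def mult_nonneg_nonpos)
    have w0: "w \<bullet> y = 0" "y \<bullet> w = 0" if "y \<in> ?V" for y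
      using u(2)[OF span_base[OF that]] by (auto simp: w_def orthogonal_def inner_commute)
    have eq: "{k..<?n} = insert k {Suc k..<?n}"
      using step.hyps by auto
    have "?P k (q(k := w))"
      unfolding eq using q w1 wk w0 by (auto simp: fun_upd_def)
    then show ?case by blast
  qed
  from this[of 0] show ?thesis by (simp add: atLeast0LessThan Ball_def)
qed

lemma lower_triangular_orthogonal_factor:
  fixes A :: "real ^ 'n ^ 'n"
  obtains Q where "orthogonal_matrix Q" "lower_triangular (A ** Q)" "\<And>i. 0 \<le> (A ** Q) $ i $ i"
proof -
  define index where "index = the_inv (position :: 'n \<Rightarrow> nat)"
  have index: "index (position i) = i" for i
    unfolding index_def by (rule the_inv_f_f) (simp add: inj_def)
  obtain q :: "nat \<Rightarrow> real ^ 'n"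
    where q: "\<forall>i<CARD('n). \<forall>j<CARD('n). q i \<bullet> q j = (if i = j then 1 else 0)"
      and aq: "\<forall>j<CARD('n). 0 \<le> A $ index j \<bullet> q j \<and> (\<forall>i<j. A $ index i \<bullet> q j = 0)"
    using triangularising_orthonormal_system[of "\<lambda>k. A $ index k"]
    by (simp only: DIM_cart DIM_real mult_1_right) blast
  define Q :: "real ^ 'n ^ 'n" where "Q = (\<chi> i j. q (position j) $ i)"
  have col: "column j Q = q (position j)" for j
    by (simp add: Q_def column_def vec_eq_iff)
  have AQ: "(A ** Q) $ i $ j = A $ i \<bullet> q (position j)" for i j
    by (simp add: matrix_matrix_mult_def Q_def inner_vec_def)
  show thesis
  proof
    show "orthogonal_matrix Q"
      using q by (simp add: orthogonal_matrix_orthonormal_columns col norm_eq_1 orthogonal_def position_less)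
    show "lower_triangular (A ** Q)"
      unfolding lower_triangular_def AQ using aq position_less index by metis
    show "0 \<le> (A ** Q) $ i $ i" for i
      unfolding AQ using aq position_less[of i] index[of i] by auto
  qed
qed

section \<open>Volumes of triangular images\<close>

text \<open>
  A copy of the index type, well-ordered by \<open>position\<close>, so that the formulas for the measure of a
  linear image and for the determinant of a triangular matrix, which speak of ordered index types,
  can be applied to it.
\<close>

typedef 'n ordered = "UNIV :: 'n set"
  morphisms unordered Ordered by simp

instance ordered :: (finite) finite
proof
  have "(UNIV :: 'a ordered set) = Ordered ` UNIV"
    by (metis Ordered_cases UNIV_eq_I image_eqI)
  then show "finite (UNIV :: 'a ordered set)" by (metis finite finite_imageI)
qed

instantiation ordered :: (finite) wellorder
begin

definition less_eq_ordered :: "'a ordered \<Rightarrow> 'a ordered \<Rightarrow> bool" where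
  "less_eq_ordered i j \<longleftrightarrow> position (unordered i) \<le> position (unordered j)"

definition less_ordered :: "'a ordered \<Rightarrow> 'a ordered \<Rightarrow> bool" where
  "less_ordered i j \<longleftrightarrow> position (unordered i) < position (unordered j)"

instance
proof
  fix P :: "'a ordered \<Rightarrow> bool" and a
  assume step: "\<And>i. (\<And>j. j < i \<Longrightarrow> P j) \<Longrightarrow> P i"
  show "P a"
  proof (induction a rule: measure_induct_rule[of "\<lambda>i. position (unordered i)"])
    case (less i)
    then show ?case by (rule step) (simp add: less_ordered_def)
  qed
qed (auto simp: less_eq_ordered_def less_ordered_def unordered_inject)

end

lemma bij_unordered: "bij (unordered :: 'n ordered \<Rightarrow> 'n)"
  by (intro bijI injI surjI[of _ Ordered]) (simp_all add: unordered_inject Ordered_inverse)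

text \<open>Boxes are mapped to boxes with the same side lengths, and they determine Lebesgue measure.\<close>

lemma lborel_reindex_coordinates:
  fixes \<pi> :: "'m::finite \<Rightarrow> 'n::finite"
  assumes "bij \<pi>"
  shows "(lborel :: (real ^ 'm) measure) = distr lborel borel (\<lambda>x. \<chi> i. x $ \<pi> i)"
proof (rule lborel_eqI)
  fix l u :: "real ^ 'm"
  define g where "g y = (\<chi> k. y $ inv \<pi> k)" for y :: "real ^ 'm"
  have prod_Basis: "(\<Prod>b\<in>Basis. x \<bullet> b) = (\<Prod>k\<in>UNIV. x $ k)" for x :: "real ^ 'k"
    by (simp add: Basis_vec_def cart_eq_inner_axis axis_eq_axis prod.UNION_disjoint)
  assume le: "\<And>b. b \<in> Basis \<Longrightarrow> l \<bullet> b \<le> u \<bullet> b"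
  then have le': "l $ i \<le> u $ i" for i
    by (metis axis_in_Basis_iff cart_eq_inner_axis Basis_real_def singletonI)
  have all_reindex: "(\<forall>i. P (\<pi> i) i) \<longleftrightarrow> (\<forall>k. P k (inv \<pi> k))" for P
    using bij_inv_eq_iff[OF assms] by metis
  have meas: "(\<lambda>x :: real ^ 'n. \<chi> i. x $ \<pi> i) \<in> borel_measurable lborel"
    by (simp add: borel_measurable_continuous_onI continuous_intros)
  have "(\<lambda>x :: real ^ 'n. \<chi> i. x $ \<pi> i) -` box l u = box (g l) (g u)"
    using all_reindex[of "\<lambda>k i. l $ i < _ $ k \<and> _ $ k < u $ i"] by (auto simp: mem_box_cart g_def)
  then have "emeasure (distr lborel borel (\<lambda>x :: real ^ 'n. \<chi> i. x $ \<pi> i)) (box l u)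
      = emeasure lborel (box (g l) (g u))"
    using meas by (subst emeasure_distr) auto
  also have "\<dots> = (\<Prod>b\<in>Basis. (g u - g l) \<bullet> b)"
  proof (rule emeasure_lborel_box)
    show "g l \<bullet> b \<le> g u \<bullet> b" if "b \<in> Basis" for b
      using that le' by (auto simp: Basis_vec_def g_def inner_axis)
  qed
  also have "(\<Prod>b\<in>Basis. (g u - g l) \<bullet> b) = (\<Prod>k\<in>UNIV. (u - l) $ inv \<pi> k)"
    by (simp only: prod_Basis) (simp add: g_def)
  also have "\<dots> = (\<Prod>i\<in>UNIV. (u - l) $ i)"
    by (rule prod.reindex_bij_betw) (rule bij_imp_bij_inv[OF assms])
  finally show "emeasure (distr lborel borel (\<lambda>x :: real ^ 'n. \<chi> i. x $ \<pi> i)) (box l u)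
      = (\<Prod>b\<in>Basis. (u - l) \<bullet> b)"
    by (simp only: prod_Basis)
qed simp

lemma measure_reindex_coordinates:
  fixes \<pi> :: "'m::finite \<Rightarrow> 'n::finite" and S :: "(real ^ 'n) set"
  assumes "bij \<pi>" "compact S"
  shows "measure lebesgue ((\<lambda>x. (\<chi> i. x $ \<pi> i) :: real ^ 'm) ` S) = measure lebesgue S"
proof -
  let ?h = "\<lambda>x :: real ^ 'n. (\<chi> i. x $ \<pi> i) :: real ^ 'm"
  have cont: "continuous_on A ?h" for A by (intro continuous_intros)
  have "inj ?h"
    unfolding inj_def vec_eq_iff by (metis assms(1) bij_pointE vec_lambda_beta)
  then have vimage: "?h -` ?h ` S = S" by (simp add: inj_vimage_image_eq)
  have borel: "S \<in> sets borel" "?h ` S \<in> sets borel"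
    using assms(2) compact_continuous_image[OF cont] by (auto intro: borel_compact)
  have meas: "?h \<in> borel_measurable lborel"
    using cont by (simp add: borel_measurable_continuous_onI)
  have "measure lborel (?h ` S) = measure (distr lborel borel ?h) (?h ` S)"
    using lborel_reindex_coordinates[OF assms(1)] by simp
  also have "\<dots> = measure lborel S"
    using meas borel by (subst measure_distr) (auto simp: vimage)
  finally show ?thesis using borel by (simp add: measure_completion)
qed

text \<open>
  After relabelling the coordinates by the ordered index type, \<open>L\<close> is lower triangular for the order
  of that type, and both the measure and the product of the diagonal entries are unchanged.
\<close>

lemma measure_lower_triangular_image:
  fixes L :: "real ^ 'n ^ 'n"
  assumes "lower_triangular L" "compact S"
  shows "measure lebesgue ((*v) L ` S) = \<bar>\<Prod>i\<in>UNIV. L $ i $ i\<bar> * measure lebesgue S"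
proof -
  let ?h = "\<lambda>x :: real ^ 'n. (\<chi> i. x $ unordered i) :: real ^ ('n ordered)"
  define M :: "real ^ ('n ordered) ^ ('n ordered)" where "M = (\<chi> i j. L $ unordered i $ unordered j)"
  have hL: "?h (L *v x) = M *v ?h x" for x
    using sum.reindex_bij_betw[OF bij_unordered, of "\<lambda>j. L $ _ $ j * x $ j"]
    by (simp add: M_def matrix_vector_mult_def vec_eq_iff)
  have "det M = (\<Prod>i\<in>UNIV. M $ i $ i)"
    using assms(1) by (intro det_lowerdiagonal) (simp add: M_def lower_triangular_def less_ordered_def)
  also have "\<dots> = (\<Prod>i\<in>UNIV. L $ i $ i)"
    using prod.reindex_bij_betw[OF bij_unordered, of "\<lambda>i. L $ i $ i"] by (simp add: M_def)
  finally have det: "det M = (\<Prod>i\<in>UNIV. L $ i $ i)" .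
  have compact: "compact (?h ` S)"
    using assms(2) by (intro compact_continuous_image continuous_intros)
  have LS: "compact ((*v) L ` S)"
    using assms(2) by (intro compact_continuous_image matrix_vector_mult_linear_continuous_on)
  have "measure lebesgue ((*v) L ` S) = measure lebesgue (?h ` (*v) L ` S)"
    by (rule measure_reindex_coordinates[OF bij_unordered LS, symmetric])
  also have "?h ` (*v) L ` S = (*v) M ` ?h ` S"
    by (simp add: image_image hL)
  also have "measure lebesgue \<dots> = \<bar>det M\<bar> * measure lebesgue (?h ` S)"
    using measure_linear_image[of "(*v) M" "?h ` S"] compact by (simp add: lmeasurable_compact)
  also have "measure lebesgue (?h ` S) = measure lebesgue S"
    by (rule measure_reindex_coordinates[OF bij_unordered assms(2)])
  finally show ?thesis unfolding det .
qed

section \<open>The parameter space\<close>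

text \<open>A pair \<open>(L, b)\<close> stands for the image of the unit ball under \<open>x \<mapsto> L x + b\<close>.\<close>

definition triangular_params :: "((real ^ 'n ^ 'n) \<times> (real ^ 'n)) set" where
  "triangular_params = {(L, b). lower_triangular L}"

text \<open>
  The ellipsoids of volume at least one. Equality would not give a convex set. The nonnegative
  diagonal selects the region where the product of the diagonal entries is log-concave.
\<close>

definition volume_params :: "((real ^ 'n ^ 'n) \<times> (real ^ 'n)) set" where
  "volume_params = {(L, b). lower_triangular L \<and> (\<forall>i. 0 \<le> L $ i $ i) \<and>
     1 \<le> (\<Prod>i\<in>UNIV. L $ i $ i) * measure lebesgue (cball 0 1 :: (real ^ 'n) set)}"

definition inscribed_params :: "(real ^ 'n) set \<Rightarrow> ((real ^ 'n ^ 'n) \<times> (real ^ 'n)) set" where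
  "inscribed_params C = {(L, b). \<forall>x\<in>cball 0 1. L *v x + b \<in> C}"

text \<open>There are \<open>n (n + 1) / 2\<close> free entries in a triangular matrix and \<open>n\<close> in the centre.\<close>

lemma dim_triangular_params:
  "dim (triangular_params :: ((real ^ 'n ^ 'n) \<times> (real ^ 'n)) set) \<le> CARD('n) * (CARD('n) + 3) div 2"
proof -
  let ?n = "CARD('n)"
  define P where "P = (SIGMA i:(UNIV :: 'n set). {j :: 'n. position j \<le> position i})"
  define B :: "((real ^ 'n ^ 'n) \<times> (real ^ 'n)) set" where
    "B = (\<lambda>(i, j). (axis i (axis j 1), 0)) ` P \<union> range (\<lambda>i. (0, axis i 1))"
  have sum_Suc: "(\<Sum>k<n. Suc k) = n * (n + 1) div 2" for n
    by (induction n) simp_all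
  have card_le: "card {j :: 'n. position j \<le> position i} \<le> Suc (position i)" for i :: 'n
  proof -
    have "card {j :: 'n. position j \<le> position i} \<le> card {..position i}"
      by (rule card_inj_on_le[of position]) (auto simp: inj_on_def)
    then show ?thesis by simp
  qed
  have "card P = (\<Sum>i\<in>(UNIV :: 'n set). card {j :: 'n. position j \<le> position i})"
    unfolding P_def by (subst card_SigmaI) auto
  also have "\<dots> \<le> (\<Sum>i\<in>(UNIV :: 'n set). Suc (position i))"
    by (intro sum_mono card_le)
  also have "\<dots> = (\<Sum>k<?n. Suc k)"
    by (rule sum.reindex_bij_betw[OF bij_betw_position])
  also have "\<dots> = ?n * (?n + 1) div 2"
    using sum_Suc[of ?n] by simp
  finally have "card P + ?n \<le> ?n * (?n + 1) div 2 + ?n" by simp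
  also have "\<dots> = ?n * (?n + 3) div 2"
  proof -
    have "?n * (?n + 3) = ?n * (?n + 1) + ?n * 2" by (simp add: algebra_simps)
    then show ?thesis by simp
  qed
  finally have cardP: "card P + ?n \<le> ?n * (?n + 3) div 2" .
  have "triangular_params \<subseteq> span B"
  proof
    fix p :: "(real ^ 'n ^ 'n) \<times> (real ^ 'n)"
    assume "p \<in> triangular_params"
    then obtain L b where p: "p = (L, b)" and L: "lower_triangular L"
      by (auto simp: triangular_params_def)
    have "(p \<bullet> e) *\<^sub>R e \<in> span B" if "e \<in> Basis" for e
    proof (cases "p \<bullet> e = 0")
      case nonzero: False
      have "e \<in> B"
        using that nonzero L
        by (auto simp: Basis_prod_def Basis_vec_def p B_def P_def inner_axis lower_triangular_def
            image_iff not_less[symmetric]) blast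
      then show ?thesis by (intro span_scale span_base)
    qed (simp add: span_zero)
    then have "(\<Sum>e\<in>Basis. (p \<bullet> e) *\<^sub>R e) \<in> span B" by (rule span_sum)
    then show "p \<in> span B" by (simp add: euclidean_representation)
  qed
  then have "dim (triangular_params :: ((real ^ 'n ^ 'n) \<times> (real ^ 'n)) set) \<le> card B"
    by (intro dim_le_card) (auto simp: B_def P_def)
  also have "card B \<le> card P + ?n"
    unfolding B_def
    by (intro order.trans[OF card_Un_le] add_mono card_image_le) (auto simp: P_def)
  finally show ?thesis using cardP by linarith
qed

text \<open>
  Log-concavity of the product, from the weighted inequality between arithmetic and geometric means
  in each factor.
\<close>

lemma prod_convex_combination_ge:
  fixes x y :: "'a \<Rightarrow> real"
  assumes "\<And>i. i \<in> A \<Longrightarrow> 0 < x i" "\<And>i. i \<in> A \<Longrightarrow> 0 < y i"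
    and "c \<le> prod x A" "c \<le> prod y A" "0 < c" and uv: "0 \<le> u" "0 \<le> v" "u + v = 1"
  shows "c \<le> (\<Prod>i\<in>A. u * x i + v * y i)"
proof -
  have "c = c powr u * c powr v"
    using uv \<open>0 < c\<close> by (simp flip: powr_add)
  also have "\<dots> \<le> prod x A powr u * prod y A powr v"
    using assms by (intro mult_mono powr_mono2) auto
  also have "\<dots> = (\<Prod>i\<in>A. x i powr u * y i powr v)"
    using assms by (simp add: prod.distrib prod_powr_distrib less_imp_le)
  also have "\<dots> \<le> (\<Prod>i\<in>A. u * x i + v * y i)"
    using assms by (intro prod_mono) (auto intro!: Youngs_inequality_0)
  finally show ?thesis .
qed

lemma content_unit_cball_pos: "0 < measure lebesgue (cball 0 1 :: (real ^ 'n) set)"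
  using content_cball_pos[of 1 "0 :: real ^ 'n"] by simp

lemma convex_volume_params: "convex (volume_params :: ((real ^ 'n ^ 'n) \<times> (real ^ 'n)) set)"
proof (rule convexI)
  let ?\<beta> = "measure lebesgue (cball 0 1 :: (real ^ 'n) set)"
  fix p p' :: "((real ^ 'n ^ 'n) \<times> (real ^ 'n))" and u v :: real
  assume "p \<in> volume_params" "p' \<in> volume_params" and uv: "0 \<le> u" "0 \<le> v" "u + v = 1"
  then obtain L b L' b' where p: "p = (L, b)" "p' = (L', b')"
    and L: "lower_triangular L" "\<And>i. 0 \<le> L $ i $ i" "1 \<le> (\<Prod>i\<in>UNIV. L $ i $ i) * ?\<beta>"
    and L': "lower_triangular L'" "\<And>i. 0 \<le> L' $ i $ i" "1 \<le> (\<Prod>i\<in>UNIV. L' $ i $ i) * ?\<beta>"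
    by (auto simp: volume_params_def)
  have pos: "0 < M $ i $ i" if "\<And>i. 0 \<le> M $ i $ i" "1 \<le> (\<Prod>i\<in>UNIV. M $ i $ i) * ?\<beta>"
    for M :: "real ^ 'n ^ 'n" and i
  proof -
    have "(\<Prod>i\<in>UNIV. M $ i $ i) \<noteq> 0"
    proof
      assume "(\<Prod>i\<in>UNIV. M $ i $ i) = 0"
      then show False using that(2) by (simp only: mult_zero_left not_one_le_zero)
    qed
    then have "M $ i $ i \<noteq> 0" by simp
    then show ?thesis using that(1)[of i] by simp
  qed
  have "1 / ?\<beta> \<le> (\<Prod>i\<in>UNIV. u * L $ i $ i + v * L' $ i $ i)"
    using uv L L' pos content_unit_cball_pos[where 'n='n]
    by (intro prod_convex_combination_ge) (auto simp: field_simps)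
  then show "u *\<^sub>R p + v *\<^sub>R p' \<in> volume_params"
    using L L' uv content_unit_cball_pos[where 'n='n] unfolding p
    by (auto simp: volume_params_def lower_triangular_def field_simps)
qed

lemma closed_volume_params: "closed (volume_params :: ((real ^ 'n ^ 'n) \<times> (real ^ 'n)) set)"
proof -
  have "volume_params = {p :: ((real ^ 'n ^ 'n) \<times> (real ^ 'n)).
      (\<forall>i j. position i < position j \<longrightarrow> fst p $ i $ j = 0) \<and> (\<forall>i. 0 \<le> fst p $ i $ i) \<and>
      1 \<le> (\<Prod>i\<in>UNIV. fst p $ i $ i) * measure lebesgue (cball 0 1 :: (real ^ 'n) set)}"
    by (auto simp: volume_params_def lower_triangular_def)
  also have "closed \<dots>"
    by (intro closed_Collect_conj closed_Collect_all closed_Collect_imp closed_Collect_le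
        closed_Collect_eq open_Collect_const continuous_intros)
  finally show ?thesis .
qed

text \<open>Needed for families with an empty colour, whose intersection is the whole space.\<close>

lemma volume_params_nonempty: "(volume_params :: ((real ^ 'n ^ 'n) \<times> (real ^ 'n)) set) \<noteq> {}"
proof -
  let ?\<beta> = "measure lebesgue (cball 0 1 :: (real ^ 'n) set)"
  define r where "r = max 1 (1 / ?\<beta>)"
  have "r ^ 1 \<le> r ^ CARD('n)"
    by (intro power_increasing) (auto simp: r_def)
  then have "1 / ?\<beta> \<le> r ^ CARD('n)" by (simp add: r_def)
  then have "(mat r, 0) \<in> (volume_params :: ((real ^ 'n ^ 'n) \<times> (real ^ 'n)) set)"
    using content_unit_cball_pos[where 'n='n]
    by (auto simp: volume_params_def lower_triangular_def mat_def r_def field_simps)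
  then show ?thesis by blast
qed

lemma inscribed_params_Inter: "inscribed_params (\<Inter>\<F>) = (\<Inter>C\<in>\<F>. inscribed_params C)"
  by (auto simp: inscribed_params_def)

text \<open>For each fixed \<open>x\<close> the condition \<open>L x + b \<in> C\<close> is a linear preimage of \<open>C\<close>.\<close>

lemma inscribed_params_closed_convex:
  assumes "closed C" "convex C"
  shows "closed (inscribed_params C)" "convex (inscribed_params C)"
proof -
  have eq: "inscribed_params C = (\<Inter>x\<in>cball 0 1. (\<lambda>p. fst p *v x + snd p) -` C)"
    by (auto simp: inscribed_params_def)
  have lin: "linear (\<lambda>p :: ((real ^ 'n ^ 'n) \<times> (real ^ 'n)). fst p *v x + snd p)" for x
    by (rule linearI) (simp_all add: matrix_vector_mult_add_rdistrib scaleR_matrix_vector_assoc algebra_simps)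
  show "closed (inscribed_params C)" unfolding eq
    using assms lin by (intro closed_INT ballI closed_vimage linear_continuous_on linear_conv_bounded_linear[THEN iffD1]) auto
  show "convex (inscribed_params C)" unfolding eq
    using assms lin by (intro convex_INT convex_linear_vimage) auto
qed

section \<open>Inscribed ellipsoids of volume one\<close>

lemma measure_lower_triangular_ellipsoid:
  fixes L :: "real ^ 'n ^ 'n"
  assumes "lower_triangular L"
  shows "measure lebesgue ((\<lambda>x. L *v x + b) ` cball 0 1)
    = \<bar>\<Prod>i\<in>UNIV. L $ i $ i\<bar> * measure lebesgue (cball 0 1 :: (real ^ 'n) set)"
proof -
  have "(\<lambda>x. L *v x + b) ` cball 0 1 = (+) b ` ((*v) L ` cball 0 1)"
    by (auto simp: image_image add.commute)
  then show ?thesis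
    by (simp only: measure_translation measure_lower_triangular_image[OF assms compact_cball])
qed

lemma invertible_if_image_nonnegligible:
  fixes A :: "real ^ 'n ^ 'n"
  assumes "measure lebesgue ((\<lambda>x. A *v x + b) ` S) \<noteq> 0"
  shows "invertible A"
proof (rule ccontr)
  assume "\<not> invertible A"
  then have "\<not> inj ((*v) A)"
    by (simp add: invertible_left_inverse matrix_left_invertible_injective)
  then have "negligible ((*v) A ` S)"
    by (intro negligible_linear_singular_image matrix_vector_mul_linear)
  then have "measure lebesgue ((+) b ` ((*v) A ` S)) = 0"
    by (simp only: measure_translation negligible_imp_measure0)
  moreover have "(+) b ` ((*v) A ` S) = (\<lambda>x. A *v x + b) ` S"
    by (auto simp: image_image add.commute)
  ultimately show False using assms by simp
qed

text \<open>
  The shrunken ellipsoid is part of the original one, as the unit ball is star-shaped about its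
  centre.
\<close>

lemma scale_inscribed_params:
  assumes "(L, b) \<in> inscribed_params C" "0 \<le> r" "r \<le> 1"
  shows "(r *\<^sub>R L, b) \<in> inscribed_params C"
proof -
  have "r *\<^sub>R L *v x + b \<in> C" if "norm x \<le> 1" for x
  proof -
    have "norm (r *\<^sub>R x) \<le> 1" using that assms by (simp add: mult_le_one)
    then have "L *v (r *\<^sub>R x) + b \<in> C"
      using assms(1) unfolding inscribed_params_def by (simp del: norm_scaleR)
    then show ?thesis by (simp add: scaleR_matrix_vector_assoc matrix_vector_mult_scaleR)
  qed
  then show ?thesis by (auto simp: inscribed_params_def)
qed

text \<open>
  From left to right, \<open>A\<close> is replaced by its triangular form \<open>A Q\<close>, which maps the ball to the same
  set. From right to left, the ellipsoid is scaled about its centre by the factor \<open>r\<close> that brings its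
  volume down to one.
\<close>

lemma contains_ellipsoid_iff_params:
  fixes C :: "(real ^ 'n) set"
  shows "contains_ellipsoid_of_volume_1 C \<longleftrightarrow> volume_params \<inter> inscribed_params C \<noteq> {}"
proof
  let ?\<beta> = "measure lebesgue (cball 0 1 :: (real ^ 'n) set)"
  assume "contains_ellipsoid_of_volume_1 C"
  then obtain A :: "real ^ 'n ^ 'n" and b
    where sub: "(\<lambda>x. A *v x + b) ` cball 0 1 \<subseteq> C"
      and vol: "measure lebesgue ((\<lambda>x. A *v x + b) ` cball 0 1) = 1"
    unfolding contains_ellipsoid_of_volume_1_def ellipsoid_def by blast
  obtain Q where Q: "orthogonal_matrix Q" and L: "lower_triangular (A ** Q)"
    and diag: "\<And>i. 0 \<le> (A ** Q) $ i $ i"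
    using lower_triangular_orthogonal_factor[of A] by metis
  have "orthogonal_transformation ((*v) Q)"
    using Q by (simp add: orthogonal_transformation_matrix)
  then have "(*v) Q ` cball 0 1 = cball 0 1"
    by (simp add: image_orthogonal_transformation_cball)
  then have "(\<lambda>x. A *v x + b) ` cball 0 1 = (\<lambda>x. A *v x + b) ` (*v) Q ` cball 0 1"
    by simp
  also have "\<dots> = (\<lambda>x. (A ** Q) *v x + b) ` cball 0 1"
    by (simp add: image_image matrix_vector_mul_assoc)
  finally have eq: "(\<lambda>x. A *v x + b) ` cball 0 1 = (\<lambda>x. (A ** Q) *v x + b) ` cball 0 1" .
  have "0 \<le> (\<Prod>i\<in>UNIV. (A ** Q) $ i $ i)"
    using diag by (intro prod_nonneg) auto
  then have "(\<Prod>i\<in>UNIV. (A ** Q) $ i $ i) * ?\<beta> = 1"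
    using vol unfolding eq measure_lower_triangular_ellipsoid[OF L] by (simp only: abs_of_nonneg)
  then have "(A ** Q, b) \<in> volume_params"
    using L diag by (simp only: volume_params_def) simp
  moreover have "(A ** Q, b) \<in> inscribed_params C"
    using sub unfolding eq inscribed_params_def by blast
  ultimately show "volume_params \<inter> inscribed_params C \<noteq> {}"
    by blast
next
  let ?\<beta> = "measure lebesgue (cball 0 1 :: (real ^ 'n) set)"
  assume "volume_params \<inter> inscribed_params C \<noteq> {}"
  then obtain L :: "real ^ 'n ^ 'n" and b
    where LV: "(L, b) \<in> volume_params" and LC: "(L, b) \<in> inscribed_params C" by auto
  define p where "p = (\<Prod>i\<in>UNIV. L $ i $ i) * ?\<beta>"
  have L: "lower_triangular L" and vol: "1 \<le> p"
    using LV by (auto simp: volume_params_def p_def)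
  define r where "r = root CARD('n) (1 / p)"
  have rn: "r ^ CARD('n) = 1 / p"
    unfolding r_def using vol by (intro real_root_pow_pos2) auto
  have r: "0 \<le> r" "r \<le> 1"
    unfolding r_def using vol by auto
  let ?E = "(\<lambda>x. (r *\<^sub>R L) *v x + b) ` cball 0 1"
  have rL: "lower_triangular (r *\<^sub>R L)"
    using L by (simp add: lower_triangular_def)
  have "\<bar>\<Prod>i\<in>UNIV. (r *\<^sub>R L) $ i $ i\<bar> * ?\<beta> = \<bar>r ^ CARD('n) * p\<bar>"
    by (simp add: p_def prod.distrib abs_mult)
  also have "\<dots> = 1" using rn vol by simp
  finally have E: "measure lebesgue ?E = 1"
    unfolding measure_lower_triangular_ellipsoid[OF rL] .
  then have "invertible (r *\<^sub>R L)"
    by (intro invertible_if_image_nonnegligible[where S = "cball 0 1" and b = b]) simp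
  then have "ellipsoid ?E"
    unfolding ellipsoid_def by blast
  moreover have "?E \<subseteq> C"
    using scale_inscribed_params[OF LC r] by (auto simp: inscribed_params_def)
  ultimately show "contains_ellipsoid_of_volume_1 C"
    unfolding contains_ellipsoid_of_volume_1_def using E by blast
qed

text \<open>
  Halving \<open>L\<close> while keeping \<open>b\<close> leaves the volume constraint aside and strictly decreases the norm,
  since a positive volume forces \<open>L \<noteq> 0\<close>.
\<close>

lemma norm_volume_params_descent:
  fixes p :: "(real ^ 'n ^ 'n) \<times> (real ^ 'n)"
  assumes "p \<in> volume_params"
  shows "\<exists>p'\<in>triangular_params. norm p' < norm p \<and>
    (\<forall>C. p \<in> inscribed_params C \<longrightarrow> p' \<in> inscribed_params C)"
proof -
  obtain L b where p: "p = (L, b)" and L: "lower_triangular L"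
    and vol: "1 \<le> (\<Prod>i\<in>UNIV. L $ i $ i) * measure lebesgue (cball 0 1 :: (real ^ 'n) set)"
    using assms by (auto simp: volume_params_def)
  have "L \<noteq> 0"
  proof
    assume "L = 0"
    then have "(\<Prod>i\<in>UNIV. L $ i $ i) = 0" by simp
    then show False using vol by (simp only: mult_zero_left not_one_le_zero)
  qed
  then have "norm (((1/2) *\<^sub>R L, b)) < norm p"
    by (simp add: p norm_Pair power_divide)
  moreover have "((1/2) *\<^sub>R L, b) \<in> triangular_params"
    using L by (simp add: triangular_params_def lower_triangular_def)
  ultimately show ?thesis
    using scale_inscribed_params[of L b _ "1/2"] unfolding p by force
qed

theorem proposition1p4:
  fixes d :: nat
    and \<C> :: "nat \<Rightarrow> (real ^ 'n) set set"
  assumes "d = CARD('n)"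
    and "\<And>i. i \<in> {1..d * (d + 3) div 2} \<Longrightarrow> finite (\<C> i)"
    and "\<And>i K. i \<in> {1..d * (d + 3) div 2} \<Longrightarrow> K \<in> \<C> i \<Longrightarrow> convex_body K"
    and "\<And>C. (\<And>i. i \<in> {1..d * (d + 3) div 2} \<Longrightarrow> C i \<in> \<C> i) \<Longrightarrow>
           contains_ellipsoid_of_volume_1 (\<Inter>i\<in>{1..d * (d + 3) div 2}. C i)"
  shows "\<exists>j\<in>{1..d * (d + 3) div 2}. contains_ellipsoid_of_volume_1 (\<Inter>(\<C> j))"
proof -
  let ?I = "{1..d * (d + 3) div 2}"
  \<comment> \<open>There is at least one colour: \<open>d (d + 3) / 2\<close> is at least two.\<close>
  have "1 * 4 \<le> d * (d + 3)"
    unfolding assms(1) by (rule mult_mono) (simp_all add: Suc_le_eq)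
  then have nonempty: "?I \<noteq> {}" by simp
  have "\<exists>j\<in>?I. volume_params \<inter> (\<Inter>C\<in>\<C> j. inscribed_params C) \<noteq> {}"
  proof (rule colourful_Helly_min_norm[where S = triangular_params and K = inscribed_params and \<C> = \<C>])
    show "dim (triangular_params :: ((real ^ 'n ^ 'n) \<times> (real ^ 'n)) set) \<le> card ?I"
      using dim_triangular_params[where 'n='n] assms(1) by simp
    show "volume_params \<subseteq> triangular_params"
      by (auto simp: volume_params_def triangular_params_def)
    show "closed (inscribed_params C) \<and> convex (inscribed_params C)" if "i \<in> ?I" "C \<in> \<C> i" for i C
      using assms(3)[OF that] inscribed_params_closed_convex[of C]
      unfolding convex_body_def by (blast intro: compact_imp_closed)
    show "volume_params \<inter> (\<Inter>i\<in>?I. inscribed_params (s i)) \<noteq> {}"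
      if "\<And>i. i \<in> ?I \<Longrightarrow> s i \<in> \<C> i" for s
      using assms(4)[of s] that unfolding contains_ellipsoid_iff_params inscribed_params_Inter image_image
      by blast
    show "\<exists>p'\<in>triangular_params. norm p' < norm p \<and>
        (\<forall>i\<in>?I. \<forall>C\<in>\<C> i. p \<in> inscribed_params C \<longrightarrow> p' \<in> inscribed_params C)"
      if "p \<in> volume_params" for p :: "((real ^ 'n ^ 'n) \<times> (real ^ 'n))"
      using norm_volume_params_descent[OF that] by blast
  qed (fact finite_atLeastAtMost nonempty closed_volume_params convex_volume_params
      volume_params_nonempty assms(2))+
  then show ?thesis
    unfolding contains_ellipsoid_iff_params inscribed_params_Inter .
qed

end
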